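(* Let $\mathcal{L}$ be a countable language and let $\Phi_0$ and $\Phi_1$ be equational theories in $\mathcal{L}$, identified with their codes in $2^\omega$. Then the interval $[\Phi_0,\Phi_1]$, viewed as a subset of the Cantor space $2^\omega$ via the coding, is $\Pi^0_1(\Phi_0\oplus\Phi_1)$.
   Context: A language is a set of function symbols, each with a specified finite arity; terms are built over a fixed countably infinite set of variables. An equation is an expression $s\approx t$ with $s,t$ terms. An equational theory is the set of all equations valid in some variety (class of algebras closed under homomorphic images, subalgebras and products). Equivalently, it is a set $\Phi$ of equations such that: $s\approx s\in\Phi$ for every term $s$; $s\approx t\in\Phi$ implies $t\approx s\in\Phi$; $s\approx t,\ t\approx u\in\Phi$ implies $s\approx u\in\Phi$; $\Phi$ is closed under replacement (if $s\approx s'\in\Phi$, $t$ is a term, and $t'$ results from replacing an occurrence of $s$ in $t$ by $s'$, then $t\approx t'\in\Phi$); and $\Phi$ is closed under substitution (simultaneously replacing every occurrence of each variable by a term). The interval is $[\Phi_0,\Phi_1]=\{\Phi : \Phi \text{ is an equational theory in } \mathcal{L} \text{ with } \Phi_0\subseteq\Phi\subseteq\Phi_1\}$ (not necessarily linearly ordered). Coding: terms and equations of $\mathcal{L}$ are coded injectively and effectively (relative to an oracle for the arity map of $\mathcal{L}$) by natural numbers through a fixed standard Gödel numbering (e.g. of strings of symbols), so that the usual syntactic relations, such as "$\phi'$ is a replacement instance of $t$ and $\phi$", are recursive. Let $\phi_i$ be the equation with code $i$. A set $\Phi$ of equations is identified with the real $A\in 2^\omega$ such that $A(i)=1$ iff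 $i$ is the code of an equation $\phi_i\in\Phi$; reals are identified with subsets of $\omega$. For $A,B\subseteq\omega$, $A\oplus B=\{2n:n\in A\}\cup\{2n+1:n\in B\}$. For $a\in 2^\omega$, a set $X\subseteq 2^\omega$ is $\Pi^0_1(a)$ if there is a predicate $R$, recursive with the parameter $a$, such that for all $b\in 2^\omega$: $b\in X$ iff $\forall m\in\omega\; R(m,b,a)$. *)

theory Defs
  imports Main "HOL-Library.Nat_Bijection" "HOL-Library.Countable_Set"
begin

text \<open>
  A language is a partial map \<open>L\<close>: its domain is the set of function symbols and \<open>L f = Some n\<close>
  says that \<open>f\<close> has arity \<open>n\<close>.  The variables are \<open>Var 0, Var 1, \<dots>\<close>.
\<close>

datatype 'f trm = Var nat | Fun 'f "'f trm list"

type_synonym 'f equation = "'f trm \<times> 'f trm"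

inductive_set terms :: "('f \<rightharpoonup> nat) \<Rightarrow> 'f trm set" for L :: "'f \<rightharpoonup> nat" where
  Var: "Var x \<in> terms L"
| Fun: "L f = Some (length ts) \<Longrightarrow> (\<forall>t \<in> set ts. t \<in> terms L) \<Longrightarrow> Fun f ts \<in> terms L"

definition equations :: "('f \<rightharpoonup> nat) \<Rightarrow> 'f equation set" where
  "equations L = terms L \<times> terms L"

primrec subst :: "(nat \<Rightarrow> 'f trm) \<Rightarrow> 'f trm \<Rightarrow> 'f trm" where
  "subst \<sigma> (Var x) = \<sigma> x"
| "subst \<sigma> (Fun f ts) = Fun f (map (subst \<sigma>) ts)"

text \<open>\<open>replace s s' t t'\<close>: the term \<open>t'\<close> results from replacing one occurrence of \<open>s\<close> in \<open>t\<close> by \<open>s'\<close>.\<close>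

inductive replace :: "'f trm \<Rightarrow> 'f trm \<Rightarrow> 'f trm \<Rightarrow> 'f trm \<Rightarrow> bool"
  for s s' :: "'f trm" where
  here: "replace s s' s s'"
| arg: "replace s s' t t' \<Longrightarrow> replace s s' (Fun f (us @ t # vs)) (Fun f (us @ t' # vs))"

definition equational_theory :: "('f \<rightharpoonup> nat) \<Rightarrow> 'f equation set \<Rightarrow> bool" where
  "equational_theory L \<Phi> \<longleftrightarrow>
     \<Phi> \<subseteq> equations L \<and>
     (\<forall>s \<in> terms L. (s, s) \<in> \<Phi>) \<and>
     (\<forall>s t. (s, t) \<in> \<Phi> \<longrightarrow> (t, s) \<in> \<Phi>) \<and>
     (\<forall>s t u. (s, t) \<in> \<Phi> \<longrightarrow> (t, u) \<in> \<Phi> \<longrightarrow> (s, u) \<in> \<Phi>) \<and>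
     (\<forall>s s' t t'. (s, s') \<in> \<Phi> \<longrightarrow> t \<in> terms L \<longrightarrow> replace s s' t t' \<longrightarrow> (t, t') \<in> \<Phi>) \<and>
     (\<forall>s t \<sigma>. (s, t) \<in> \<Phi> \<longrightarrow> (\<forall>x. \<sigma> x \<in> terms L) \<longrightarrow> (subst \<sigma> s, subst \<sigma> t) \<in> \<Phi>)"

definition theory_interval ::
  "('f \<rightharpoonup> nat) \<Rightarrow> 'f equation set \<Rightarrow> 'f equation set \<Rightarrow> 'f equation set set" where
  "theory_interval L \<Phi>\<^sub>0 \<Phi>\<^sub>1 = {\<Phi>. equational_theory L \<Phi> \<and> \<Phi>\<^sub>0 \<subseteq> \<Phi> \<and> \<Phi> \<subseteq> \<Phi>\<^sub>1}"

text \<open>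
  The Goedel numbering depends on a numbering \<open>num\<close> of the function symbols, which is to be
  injective on the symbols of the language.  Not every natural number is the code of an equation.
\<close>

primrec term_code :: "('f \<Rightarrow> nat) \<Rightarrow> 'f trm \<Rightarrow> nat" where
  "term_code num (Var x) = sum_encode (Inl x)"
| "term_code num (Fun f ts) =
     sum_encode (Inr (prod_encode (num f, list_encode (map (term_code num) ts))))"

definition equation_code :: "('f \<Rightarrow> nat) \<Rightarrow> 'f equation \<Rightarrow> nat" where
  "equation_code num e = prod_encode (term_code num (fst e), term_code num (snd e))"

text \<open>Reals are subsets of \<open>\<omega>\<close>, i.e. elements of \<^typ>\<open>nat set\<close>.\<close>

definition theory_code :: "('f \<Rightarrow> nat) \<Rightarrow> 'f equation set \<Rightarrow> nat set" where
  "theory_code num \<Phi> = equation_code num ` \<Phi>"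

inductive_cases terms_FunE: "Fun f ts \<in> terms L"

lemma term_code_inj:
  assumes "inj_on num (dom L)" "s \<in> terms L" "t \<in> terms L" "term_code num s = term_code num t"
  shows "s = t"
  using assms(2-4)
proof (induction s arbitrary: t rule: terms.induct)
  case (Var x)
  then show ?case by (cases t) (auto simp: sum_encode_eq)
next
  case (Fun f ts)
  from Fun.prems(2) obtain g us where t: "t = Fun g us"
    by (cases t) (auto simp: sum_encode_eq)
  with Fun.prems(1) have g: "L g = Some (length us)" "\<forall>u \<in> set us. u \<in> terms L"
    by (auto elim: terms_FunE)
  from Fun.prems(2) t have "num f = num g" and
    m: "map (term_code num) ts = map (term_code num) us"
    by (auto simp: sum_encode_eq prod_encode_eq list_encode_eq)
  moreover have "f = g"
    using assms(1) Fun.hyps g(1) \<open>num f = num g\<close> by (auto dest!: inj_onD)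
  moreover have "ts = us"
  proof (rule nth_equalityI)
    show l: "length ts = length us" using m by (rule map_eq_imp_length_eq)
    fix i assume i: "i < length ts"
    with m l have "term_code num (ts ! i) = term_code num (us ! i)"
      by (metis nth_map)
    with i l g(2) Fun.IH show "ts ! i = us ! i" by auto
  qed
  ultimately show ?case using t by simp
qed

lemma equation_code_inj_on:
  assumes "inj_on num (dom L)"
  shows "inj_on (equation_code num) (equations L)"
  using term_code_inj[OF assms]
  by (intro inj_onI) (simp add: equations_def equation_code_def prod_encode_eq mem_Times_iff prod_eq_iff)

definition join :: "nat set \<Rightarrow> nat set \<Rightarrow> nat set" where
  "join A B = {2 * n | n. n \<in> A} \<union> {2 * n + 1 | n. n \<in> B}"

text \<open>
  Partial recursive functions with two set oracles, an argument \<open>b\<close> and a parameter \<open>a\<close>.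
  \<open>computes b a p xs y\<close>: the program \<open>p\<close>, run on input \<open>xs\<close> with oracles \<open>b\<close> and \<open>a\<close>, halts with
  output \<open>y\<close>.  The recursion variable of \<open>Prec\<close> and the search variable of \<open>Mu\<close> come first.
\<close>

datatype prog =
    Zero | Succ | Proj nat | QueryArg | QueryPar
  | Comp prog "prog list" | Prec prog prog | Mu prog

inductive computes :: "nat set \<Rightarrow> nat set \<Rightarrow> prog \<Rightarrow> nat list \<Rightarrow> nat \<Rightarrow> bool"
  for b a :: "nat set" where
  Zero: "computes b a Zero xs 0"
| Succ: "computes b a Succ [x] (Suc x)"
| Proj: "i < length xs \<Longrightarrow> computes b a (Proj i) xs (xs ! i)"
| QueryArg: "computes b a QueryArg [x] (if x \<in> b then 1 else 0)"
| QueryPar: "computes b a QueryPar [x] (if x \<in> a then 1 else 0)"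
| Comp: "list_all2 (\<lambda>q y. computes b a q xs y) qs ys \<Longrightarrow> computes b a p ys z \<Longrightarrow>
    computes b a (Comp p qs) xs z"
| Prec_0: "computes b a p xs y \<Longrightarrow> computes b a (Prec p q) (0 # xs) y"
| Prec_Suc: "computes b a (Prec p q) (n # xs) y \<Longrightarrow> computes b a q (n # y # xs) z \<Longrightarrow>
    computes b a (Prec p q) (Suc n # xs) z"
| Mu: "computes b a p (n # xs) 0 \<Longrightarrow> (\<forall>k<n. \<exists>y. computes b a p (k # xs) (Suc y)) \<Longrightarrow>
    computes b a (Mu p) xs n"

inductive_cases computes_ZeroE: "computes b a Zero xs z"
inductive_cases computes_SuccE: "computes b a Succ xs z"
inductive_cases computes_ProjE: "computes b a (Proj i) xs z"
inductive_cases computes_QueryArgE: "computes b a QueryArg xs z"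
inductive_cases computes_QueryParE: "computes b a QueryPar xs z"
inductive_cases computes_CompE: "computes b a (Comp p qs) xs z"
inductive_cases computes_Prec_0E: "computes b a (Prec p q) (0 # xs) z"
inductive_cases computes_Prec_SucE: "computes b a (Prec p q) (Suc n # xs) z"
inductive_cases computes_MuE: "computes b a (Mu p) xs z"

lemma computes_deterministic: "computes b a p xs y \<Longrightarrow> computes b a p xs z \<Longrightarrow> y = z"
proof (induction arbitrary: z rule: computes.induct)
  case (Comp xs qs ys p y)
  from Comp.prems obtain ys' where
    ys': "list_all2 (\<lambda>q y. computes b a q xs y) qs ys'" "computes b a p ys' z"
    by (rule computes_CompE)
  have "ys = ys'"
    using Comp.IH(1) ys'(1) by (auto simp: list_all2_conv_all_nth intro!: nth_equalityI)
  with Comp.IH(2) ys'(2) show ?case by blast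
next
  case (Mu p n xs)
  from Mu.prems have z: "computes b a p (z # xs) 0" "\<forall>k<z. \<exists>y. computes b a p (k # xs) (Suc y)"
    by (auto elim: computes_MuE)
  show ?case
  proof (rule linorder_cases[of n z])
    assume "n < z" with z Mu.IH(1) show ?thesis by (metis nat.distinct(1))
  next
    assume "z < n" with z Mu.IH(2) show ?thesis by (metis nat.distinct(1))
  qed
next
  case (Prec_Suc p q n xs y z')
  from Prec_Suc.prems obtain y' where
    "computes b a (Prec p q) (n # xs) y'" "computes b a q (n # y' # xs) z"
    by (rule computes_Prec_SucE)
  with Prec_Suc.IH show ?case by metis
qed (erule computes_ZeroE computes_SuccE computes_ProjE computes_QueryArgE computes_QueryParE computes_Prec_0E; simp)+

text \<open>
  Recursiveness with parameter \<open>a\<close>: a single program decides \<open>R m b a\<close> for all \<open>m\<close> and all \<open>b\<close>;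
  it has to halt for every real \<open>b\<close>.
\<close>

definition recursive_with_parameter ::
  "nat set \<Rightarrow> (nat \<Rightarrow> nat set \<Rightarrow> nat set \<Rightarrow> bool) \<Rightarrow> bool" where
  "recursive_with_parameter a R \<longleftrightarrow>
     (\<exists>p. \<forall>m b. computes b a p [m] (if R m b a then 1 else 0))"

definition Pi01 :: "nat set \<Rightarrow> nat set set \<Rightarrow> bool" where
  "Pi01 a X \<longleftrightarrow>
     (\<exists>R. recursive_with_parameter a R \<and> (\<forall>b. b \<in> X \<longleftrightarrow> (\<forall>m. R m b a)))"

end

theory Submission
  imports Defs
begin

text \<open>
  A set \<open>b\<close> is the code of a theory in the interval if and only if it lies between the codes of
  \<open>\<Phi>\<^sub>0\<close> and \<open>\<Phi>\<^sub>1\<close> and is closed under symmetry, transitivity, replacement and substitution, read as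
  conditions on codes (\<open>mem_interval_codes_iff\<close>).  Each of these conditions has the form
  ``for all numbers, if \<open>b\<close> contains these codes and some recursive relation holds, then \<open>b\<close> contains
  that code'', and such conditions are \<open>\<Pi>\<^sup>0\<^sub>1\<close> in any parameter that decides the relations involved.
  Which numbers are codes of terms depends on the language, but the parameter decides it: since
  \<open>\<Phi>\<^sub>0\<close> is reflexive, \<open>x\<close> is the code of a term if and only if \<open>\<Phi>\<^sub>0\<close> contains the code of the
  equation whose two sides have the code \<open>x\<close> (\<open>diagonal_theory_code\<close>).

  That one term arises from others by replacement or substitution is recognised without
  recursion on terms.  It is witnessed by a certificate: a finite relation between codes which is
  locally correct, in that every pair of the relation is justified by pairs between the immediate
  parts of its two codes (\<open>one_place\<close> and \<open>subst_graph\<close>).  A finite relation is coded by a number, and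
  local correctness is a bounded formula.  As the certificates occur in hypotheses, quantifying over
  them adds only universal quantifiers to the conditions on \<open>b\<close>.  Local correctness suffices
  because the parts of a code are smaller than the code: by induction, a certificate relates codes
  only as a true replacement or substitution does (\<open>one_place_differ\<close>, \<open>subst_graph_is_subst\<close>), and
  conversely each replacement or substitution in a given equation has a finite certificate
  (\<open>one_place_exists\<close>, \<open>subst_graph_exists\<close>).

  What remains is to exhibit programs.  The predicates that are decidable with the two oracles are
  shown to be closed under bounded quantification and to include membership in the set coded by a
  number (\<open>recursive_bex_le\<close>, \<open>recursive_mem_set_decode\<close>), and the \<open>\<Pi>\<^sup>0\<^sub>1\<close> predicates are shown to be closed
  under conjunction and universal quantification (\<open>Pi_conj\<close>, \<open>Pi_all\<close>).  With these rules the programs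
  are found by decomposing the formulas.
\<close>

section \<open>Functionals and predicates recursive in an oracle\<close>

text \<open>
  One program has to serve all \<open>b\<close>, and its values are prescribed on inputs of length \<open>k\<close> only.
  The list \<open>xs\<close> is a context of de Bruijn style variables: a binder puts its variable at the head,
  so that the variables are \<open>hd xs\<close>, \<open>hd (tl xs)\<close>, \dots
\<close>

definition recursive_fun :: "nat set \<Rightarrow> nat \<Rightarrow> (nat set \<Rightarrow> nat list \<Rightarrow> nat) \<Rightarrow> bool" where
  "recursive_fun a k F \<longleftrightarrow> (\<exists>p. \<forall>b xs. length xs = k \<longrightarrow> computes b a p xs (F b xs))"

abbreviation recursive_pred :: "nat set \<Rightarrow> nat \<Rightarrow> (nat set \<Rightarrow> nat list \<Rightarrow> bool) \<Rightarrow> bool" where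
  "recursive_pred a k P \<equiv> recursive_fun a k (\<lambda>b xs. of_bool (P b xs))"

lemma recursive_fun_cong:
  assumes "\<And>b xs. length xs = k \<Longrightarrow> F b xs = G b xs"
  shows "recursive_fun a k F \<longleftrightarrow> recursive_fun a k G"
  unfolding recursive_fun_def using assms by (metis (full_types))

lemma recursive_zero: "recursive_fun a k (\<lambda>b xs. 0)"
  unfolding recursive_fun_def by (blast intro: computes.Zero)

lemma recursive_unary:
  assumes p: "\<And>b x. computes b a p [x] (f b x)" and F: "recursive_fun a k F"
  shows "recursive_fun a k (\<lambda>b xs. f b (F b xs))"
proof -
  obtain q where "\<And>b xs. length xs = k \<Longrightarrow> computes b a q xs (F b xs)"
    using F unfolding recursive_fun_def by blast
  then have "length xs = k \<Longrightarrow> computes b a (Comp p [q]) xs (f b (F b xs))" for b xs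
    by (auto intro!: computes.Comp[where ys = "[F b xs]"] p)
  then show ?thesis unfolding recursive_fun_def by blast
qed

lemma recursive_Suc: "recursive_fun a k F \<Longrightarrow> recursive_fun a k (\<lambda>b xs. Suc (F b xs))"
  by (rule recursive_unary[where p = Succ]) (rule computes.Succ)

lemma recursive_mem_argument:
  "recursive_fun a k F \<Longrightarrow> recursive_pred a k (\<lambda>b xs. F b xs \<in> b)"
  by (rule recursive_unary[where p = QueryArg])
    (simp_all add: of_bool_def computes.QueryArg[simplified])

lemma recursive_mem_parameter:
  "recursive_fun a k F \<Longrightarrow> recursive_pred a k (\<lambda>b xs. F b xs \<in> a)"
  by (rule recursive_unary[where p = QueryPar])
    (simp_all add: of_bool_def computes.QueryPar[simplified])

lemma computes_projections:
  assumes "\<forall>i \<in> set is. i < length xs"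
  shows "list_all2 (\<lambda>q y. computes b a q xs y) (map Proj is) (map ((!) xs) is)"
  using assms by (simp add: list_all2_conv_all_nth computes.Proj)

lemma recursive_rename:
  assumes "recursive_fun a k F" "length is = k" "\<forall>i \<in> set is. i < k'"
  shows "recursive_fun a k' (\<lambda>b xs. F b (map ((!) xs) is))"
proof -
  obtain p where "\<And>b xs. length xs = k \<Longrightarrow> computes b a p xs (F b xs)"
    using assms(1) unfolding recursive_fun_def by blast
  then have "length xs = k' \<Longrightarrow> computes b a (Comp p (map Proj is)) xs (F b (map ((!) xs) is))"
    for b xs
    using assms(2,3) by (intro computes.Comp[OF computes_projections]) auto
  then show ?thesis unfolding recursive_fun_def by blast
qed

lemma map_nth_drop: "length xs = n + k \<Longrightarrow> map ((!) xs) [n..<n + k] = drop n xs"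
  by (rule nth_equalityI) auto

lemma recursive_hd: "recursive_fun a (Suc k) (\<lambda>b xs. hd xs)"
proof -
  have "computes b a (Proj 0) xs (hd xs)" if "length xs = Suc k" for b xs
    using computes.Proj[of 0 xs b a] that by (cases xs) auto
  then show ?thesis unfolding recursive_fun_def by blast
qed

lemma recursive_weaken:
  assumes "recursive_fun a k F"
  shows "recursive_fun a (Suc k) (\<lambda>b xs. F b (tl xs))"
proof -
  have "recursive_fun a (Suc k) (\<lambda>b xs. F b (map ((!) xs) [1..<1 + k]))"
    by (rule recursive_rename[OF assms]) auto
  also have "?this \<longleftrightarrow> ?thesis"
    by (rule recursive_fun_cong) (simp only: map_nth_drop drop_Suc drop_0 One_nat_def plus_1_eq_Suc)
  finally show ?thesis .
qed

lemma recursive_weaken_second: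
  assumes "recursive_fun a (Suc k) F"
  shows "recursive_fun a (Suc (Suc k)) (\<lambda>b xs. F b (hd xs # tl (tl xs)))"
proof -
  have "recursive_fun a (Suc (Suc k)) (\<lambda>b xs. F b (map ((!) xs) (0 # [2..<2 + k])))"
    by (rule recursive_rename[OF assms]) auto
  also have "?this \<longleftrightarrow> ?thesis"
  proof (rule recursive_fun_cong)
    fix b and xs :: "nat list"
    assume l: "length xs = Suc (Suc k)"
    then have "map ((!) xs) (0 # [2..<2 + k]) = hd xs # tl (tl xs)"
      using map_nth_drop[of xs 2 k] by (cases xs) (simp_all add: numeral_2_eq_2 drop_Suc)
    then show "F b (map ((!) xs) (0 # [2..<2 + k])) = F b (hd xs # tl (tl xs))" by simp
  qed
  finally show ?thesis .
qed

text \<open>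
  The one source of loops: all other functions and predicates are obtained from primitive
  recursion.  In the premise for the step function, as in every rule for a binder below, the bound
  variables occur as heads of the context, so that higher-order matching can apply the rule.
\<close>

lemma recursive_rec_nat:
  assumes G: "recursive_fun a k G" and N: "recursive_fun a k N"
    and H: "recursive_fun a (Suc (Suc k)) (\<lambda>b ys. H b (tl (tl ys)) (hd ys) (hd (tl ys)))"
  shows "recursive_fun a k (\<lambda>b xs. rec_nat (G b xs) (\<lambda>n y. H b xs n y) (N b xs))"
proof -
  obtain g where g: "\<And>b xs. length xs = k \<Longrightarrow> computes b a g xs (G b xs)"
    using G unfolding recursive_fun_def by blast
  obtain m where m: "\<And>b xs. length xs = k \<Longrightarrow> computes b a m xs (N b xs)"
    using N unfolding recursive_fun_def by blast
  obtain h where h: "\<And>b ys. length ys = Suc (Suc k) \<Longrightarrow>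
      computes b a h ys (H b (tl (tl ys)) (hd ys) (hd (tl ys)))"
    using H unfolding recursive_fun_def by blast
  have "computes b a (Comp (Prec g h) (m # map Proj [0..<k])) xs
      (rec_nat (G b xs) (\<lambda>n y. H b xs n y) (N b xs))" if l: "length xs = k" for b xs
  proof (rule computes.Comp)
    have "list_all2 (\<lambda>q y. computes b a q xs y) (map Proj [0..<k]) xs"
      using computes_projections[of "[0..<k]" xs b a] l map_nth[of xs] by simp
    then show "list_all2 (\<lambda>q y. computes b a q xs y) (m # map Proj [0..<k]) (N b xs # xs)"
      using m[OF l] by simp
    have "computes b a (Prec g h) (n # xs) (rec_nat (G b xs) (\<lambda>n y. H b xs n y) n)" for n
    proof (induction n)
      case 0
      then show ?case using g[OF l] by (auto intro: computes.Prec_0)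
    next
      case (Suc n)
      from Suc.IH show ?case
        by (rule computes.Prec_Suc) (use l in \<open>simp add: h[of "n # _ # xs" b, simplified]\<close>)
    qed
    then show "computes b a (Prec g h) (N b xs # xs)
      (rec_nat (G b xs) (\<lambda>n y. H b xs n y) (N b xs))" .
  qed
  then show ?thesis unfolding recursive_fun_def by blast
qed

section \<open>Arithmetic, propositional connectives and bounded quantifiers\<close>

lemmas recursive_base = recursive_zero recursive_Suc recursive_hd recursive_weaken

lemma recursive_one: "recursive_fun a k (\<lambda>b xs. 1)"
  using recursive_Suc[OF recursive_zero] by simp

lemma recursive_plus:
  assumes F: "recursive_fun a k F" and G: "recursive_fun a k G"
  shows "recursive_fun a k (\<lambda>b xs. F b xs + G b xs)"
proof -
  have "rec_nat n (\<lambda>_ y. Suc y) m = m + n" for m n :: nat by (induction m) auto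
  moreover have "recursive_fun a k (\<lambda>b xs. rec_nat (G b xs) (\<lambda>_ y. Suc y) (F b xs))"
    by (rule recursive_rec_nat) (intro F G recursive_base)+
  ultimately show ?thesis by simp
qed

lemma recursive_predecessor:
  assumes F: "recursive_fun a k F"
  shows "recursive_fun a k (\<lambda>b xs. F b xs - 1)"
proof -
  have "rec_nat 0 (\<lambda>i _. i) n = n - 1" for n :: nat by (cases n) auto
  moreover have "recursive_fun a k (\<lambda>b xs. rec_nat 0 (\<lambda>i _. i) (F b xs))"
    by (rule recursive_rec_nat) (intro F recursive_base)+
  ultimately show ?thesis by simp
qed

lemma recursive_minus:
  assumes F: "recursive_fun a k F" and G: "recursive_fun a k G"
  shows "recursive_fun a k (\<lambda>b xs. F b xs - G b xs)"
proof -
  have "rec_nat m (\<lambda>_ y. y - 1) n = m - n" for m n :: nat by (induction n) auto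
  moreover have "recursive_fun a k (\<lambda>b xs. rec_nat (F b xs) (\<lambda>_ y. y - 1) (G b xs))"
    by (rule recursive_rec_nat) (intro F G recursive_predecessor recursive_base)+
  ultimately show ?thesis by simp
qed

text \<open>
  On the truth values \<open>0\<close> and \<open>1\<close> truncated subtraction expresses the connectives: \<open>1 - p\<close> is the
  negation and \<open>1 - (1 - p - q)\<close> the disjunction.
\<close>

lemma recursive_not:
  assumes "recursive_pred a k P"
  shows "recursive_pred a k (\<lambda>b xs. \<not> P b xs)"
proof -
  have "of_bool (\<not> A) = (1 :: nat) - of_bool A" for A by simp
  then show ?thesis by (simp only:) (intro recursive_minus recursive_one assms)
qed

lemma recursive_disj:
  assumes "recursive_pred a k P" "recursive_pred a k Q"
  shows "recursive_pred a k (\<lambda>b xs. P b xs \<or> Q b xs)"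
proof -
  have "of_bool (A \<or> B) = (1 :: nat) - (1 - of_bool A - of_bool B)" for A B by auto
  then show ?thesis by (simp only:) (intro recursive_minus recursive_one assms)
qed

lemma recursive_conj:
  assumes "recursive_pred a k P" "recursive_pred a k Q"
  shows "recursive_pred a k (\<lambda>b xs. P b xs \<and> Q b xs)"
  using recursive_not[OF recursive_disj[OF assms[THEN recursive_not]]] by simp

lemma recursive_imp:
  assumes "recursive_pred a k P" "recursive_pred a k Q"
  shows "recursive_pred a k (\<lambda>b xs. P b xs \<longrightarrow> Q b xs)"
  using recursive_disj[OF recursive_not[OF assms(1)] assms(2)] by (simp only: imp_conv_disj)

lemma recursive_le:
  assumes "recursive_fun a k F" "recursive_fun a k G"
  shows "recursive_pred a k (\<lambda>b xs. F b xs \<le> G b xs)"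
proof -
  have "of_bool (m \<le> n) = 1 - (m - n)" for m n :: nat by auto
  then show ?thesis by (simp only:) (intro recursive_minus recursive_one assms)
qed

lemma recursive_eq:
  assumes "recursive_fun a k F" "recursive_fun a k G"
  shows "recursive_pred a k (\<lambda>b xs. F b xs = G b xs)"
  unfolding eq_iff by (intro recursive_conj recursive_le assms)

lemma recursive_bex_le:
  assumes N: "recursive_fun a k N" and P: "recursive_pred a (Suc k) (\<lambda>b ys. P b (tl ys) (hd ys))"
  shows "recursive_pred a k (\<lambda>b xs. \<exists>x\<le>N b xs. P b xs x)"
proof -
  have eq: "of_bool (\<exists>x\<le>n. A x) = rec_nat (0 :: nat) (\<lambda>i y. 1 - (1 - of_bool (A i) - y)) (Suc n)" for n A
  proof -
    let ?f = "rec_nat (0 :: nat) (\<lambda>i y. 1 - (1 - of_bool (A i) - y))"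
    have "?f m = of_bool (\<exists>x<m. A x)" for m
    proof (induction m)
      case (Suc m)
      have "?f (Suc m) = 1 - (1 - of_bool (A m) - of_bool (\<exists>x<m. A x))"
        by (simp only: nat.rec(2) Suc.IH)
      also have "\<dots> = of_bool (A m \<or> (\<exists>x<m. A x))" by auto
      also have "(A m \<or> (\<exists>x<m. A x)) = (\<exists>x<Suc m. A x)" by (auto simp: less_Suc_eq)
      finally show ?case .
    qed simp
    then show ?thesis by (simp only: less_Suc_eq_le)
  qed
  have "recursive_pred a (Suc (Suc k)) (\<lambda>b ys. P b (tl (tl ys)) (hd ys))"
    using recursive_weaken_second[OF P] by simp
  then have "recursive_fun a k
      (\<lambda>b xs. rec_nat 0 (\<lambda>i y. 1 - (1 - of_bool (P b xs i) - y)) (Suc (N b xs)))"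
    by (intro recursive_rec_nat recursive_minus recursive_one recursive_base N)
  then show ?thesis by (simp only: eq)
qed

lemma recursive_ball_le:
  assumes "recursive_fun a k N" "recursive_pred a (Suc k) (\<lambda>b ys. P b (tl ys) (hd ys))"
  shows "recursive_pred a k (\<lambda>b xs. \<forall>x\<le>N b xs. P b xs x)"
  using recursive_not[OF recursive_bex_le[OF assms(1) recursive_not[OF assms(2)]]] by simp

lemma recursive_prod_encode:
  assumes F: "recursive_fun a k F" and G: "recursive_fun a k G"
  shows "recursive_fun a k (\<lambda>b xs. prod_encode (F b xs, G b xs))"
proof -
  have "triangle n = rec_nat 0 (\<lambda>i y. y + Suc i) n" for n by (induction n) auto
  then have eq: "prod_encode (m, n) = rec_nat 0 (\<lambda>i y. y + Suc i) (m + n) + m" for m n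
    by (simp add: prod_encode_def)
  show ?thesis
    unfolding eq
    by (rule recursive_plus[OF recursive_rec_nat F])
      (intro F G recursive_plus recursive_base)+
qed

text \<open>
  Membership in the finite set coded by \<open>n\<close> is a binary digit of \<open>n\<close>: halve \<open>n\<close> repeatedly and
  take the parity.  Parity and halving are themselves primitive recursions, because
  \<open>Suc i mod 2 = 1 - i mod 2\<close> and \<open>Suc i div 2 = i div 2 + i mod 2\<close>.
\<close>

lemma recursive_mem_set_decode:
  assumes F: "recursive_fun a k F" and G: "recursive_fun a k G"
  shows "recursive_pred a k (\<lambda>b xs. F b xs \<in> set_decode (G b xs))"
proof -
  have mod: "recursive_fun a k (\<lambda>b xs. H b xs mod 2)" if H: "recursive_fun a k H" for k H
  proof -
    have "rec_nat 0 (\<lambda>_ y. 1 - y) n = n mod 2" for n :: nat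
      by (induction n) (simp_all, presburger)
    moreover have "recursive_fun a k (\<lambda>b xs. rec_nat 0 (\<lambda>_ y. 1 - y) (H b xs))"
      by (rule recursive_rec_nat) (intro H recursive_minus recursive_one recursive_base)+
    ultimately show ?thesis by simp
  qed
  have half: "recursive_fun a k (\<lambda>b xs. H b xs div 2)" if H: "recursive_fun a k H" for k H
  proof -
    have "rec_nat 0 (\<lambda>i y. y + i mod 2) n = n div 2" for n :: nat
      by (induction n) (simp_all, presburger)
    moreover have "recursive_fun a k (\<lambda>b xs. rec_nat 0 (\<lambda>i y. y + i mod 2) (H b xs))"
      by (rule recursive_rec_nat) (intro H recursive_plus mod recursive_base)+
    ultimately show ?thesis by simp
  qed
  have "rec_nat n (\<lambda>_ y. y div 2) i = n div 2 ^ i" for n i :: nat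
    by (induction i) (simp_all add: div_mult2_eq power_Suc2 del: power_Suc)
  then have eq: "of_bool (i \<in> set_decode n) = rec_nat n (\<lambda>_ y. y div 2) i mod 2" for n i
    by (simp add: set_decode_def odd_iff_mod_2_eq_one)
  show ?thesis
    unfolding eq
    by (rule mod, rule recursive_rec_nat) (intro F G half recursive_base)+
qed

lemma recursive_mem_join:
  assumes "recursive_fun (join A B) k F"
  shows "recursive_pred (join A B) k (\<lambda>b xs. F b xs \<in> A)"
    and "recursive_pred (join A B) k (\<lambda>b xs. F b xs \<in> B)"
proof -
  have "n + n = 2 * m \<longleftrightarrow> m = n" "n + n \<noteq> Suc (2 * m)" "Suc (n + n) \<noteq> 2 * m" for m n :: nat
    by presburger+
  then have "n \<in> A \<longleftrightarrow> n + n \<in> join A B" "n \<in> B \<longleftrightarrow> Suc (n + n) \<in> join A B" for n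
    by (simp_all add: join_def)
  then show "recursive_pred (join A B) k (\<lambda>b xs. F b xs \<in> A)"
    and "recursive_pred (join A B) k (\<lambda>b xs. F b xs \<in> B)"
    by (simp_all only:) (intro recursive_mem_parameter recursive_Suc recursive_plus assms)+
qed

text \<open>
  These rules decompose any bounded formula down to its variables.  Weakening is the last one,
  because its conclusion is so general that it must be tried only on what the other rules leave:
  variables and functions that skip the head of the context.
\<close>

lemmas recursive_intros = recursive_zero recursive_Suc recursive_plus recursive_prod_encode
  recursive_mem_argument recursive_mem_set_decode recursive_mem_join recursive_not recursive_conj
  recursive_disj recursive_imp recursive_eq recursive_bex_le recursive_ball_le
  recursive_hd recursive_weaken

section \<open>Relations that are \<open>\<Pi>\<^sup>0\<^sub>1\<close> in the parameter\<close>

definition Pi_pred :: "nat set \<Rightarrow> nat \<Rightarrow> (nat set \<Rightarrow> nat list \<Rightarrow> bool) \<Rightarrow> bool" where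
  "Pi_pred a k P \<longleftrightarrow> (\<exists>Q. recursive_pred a (Suc k) Q \<and>
     (\<forall>b xs. length xs = k \<longrightarrow> (P b xs \<longleftrightarrow> (\<forall>m. Q b (m # xs)))))"

lemma Pi_recursive:
  assumes "recursive_pred a k P"
  shows "Pi_pred a k P"
  unfolding Pi_pred_def using recursive_weaken[OF assms]
  by (intro exI[of _ "\<lambda>b ys. P b (tl ys)"]) simp

lemma Pi_conj:
  assumes "Pi_pred a k P" "Pi_pred a k P'"
  shows "Pi_pred a k (\<lambda>b xs. P b xs \<and> P' b xs)"
proof -
  obtain Q Q' where Q: "recursive_pred a (Suc k) Q" "recursive_pred a (Suc k) Q'"
    "\<And>b xs. length xs = k \<Longrightarrow> P b xs \<longleftrightarrow> (\<forall>m. Q b (m # xs))"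
    "\<And>b xs. length xs = k \<Longrightarrow> P' b xs \<longleftrightarrow> (\<forall>m. Q' b (m # xs))"
    using assms unfolding Pi_pred_def by blast
  show ?thesis
    unfolding Pi_pred_def using recursive_conj[OF Q(1,2)] Q(3,4)
    by (intro exI[of _ "\<lambda>b ys. Q b ys \<and> Q' b ys"]) auto
qed

text \<open>
  Two universal quantifiers are contracted into one by letting the new variable bound both.
\<close>

lemma Pi_all:
  assumes "Pi_pred a (Suc k) (\<lambda>b ys. P b (tl ys) (hd ys))"
  shows "Pi_pred a k (\<lambda>b xs. \<forall>x. P b xs x)"
proof -
  obtain Q where Q: "recursive_pred a (Suc (Suc k)) Q"
    "\<And>b ys. length ys = Suc k \<Longrightarrow> P b (tl ys) (hd ys) \<longleftrightarrow> (\<forall>m. Q b (m # ys))"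
    using assms unfolding Pi_pred_def by blast
  have "recursive_pred a (Suc (Suc (Suc k))) (\<lambda>b ys. Q b (map ((!) ys) (1 # 0 # [3..<3 + k])))"
    by (rule recursive_rename[OF Q(1)]) auto
  also have "?this \<longleftrightarrow> recursive_pred a (Suc (Suc (Suc k)))
      (\<lambda>b ys. Q b (hd (tl ys) # hd ys # tl (tl (tl ys))))"
  proof (rule recursive_fun_cong)
    fix b and ys :: "nat list"
    assume l: "length ys = Suc (Suc (Suc k))"
    then obtain x y zs where "ys = x # y # zs" by (metis length_Suc_conv)
    then have "map ((!) ys) (1 # 0 # [3..<3 + k]) = hd (tl ys) # hd ys # tl (tl (tl ys))"
      using map_nth_drop[of ys 3 k] l by (simp add: numeral_3_eq_3 drop_Suc)
    then show "of_bool (Q b (map ((!) ys) (1 # 0 # [3..<3 + k])))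
        = (of_bool (Q b (hd (tl ys) # hd ys # tl (tl (tl ys)))) :: nat)" by simp
  qed
  finally have "recursive_pred a (Suc k) (\<lambda>b ys. \<forall>m\<le>hd ys. \<forall>x\<le>hd ys. Q b (m # x # tl ys))"
    by (intro recursive_ball_le recursive_base)
  moreover have "(\<forall>x. P b xs x) \<longleftrightarrow> (\<forall>n. \<forall>m\<le>n. \<forall>x\<le>n. Q b (m # x # xs))"
    if "length xs = k" for b xs
    using Q(2)[of "_ # xs" b] that by simp (metis max.cobounded1 max.cobounded2)
  ultimately show ?thesis unfolding Pi_pred_def
    by (intro exI[of _ "\<lambda>b ys. \<forall>m\<le>hd ys. \<forall>x\<le>hd ys. Q b (m # x # tl ys)"]) simp
qed

lemma Pi01_if_Pi_pred:
  assumes "Pi_pred a 0 (\<lambda>b xs. b \<in> X)"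
  shows "Pi01 a X"
proof -
  obtain Q p where Q: "\<And>b. b \<in> X \<longleftrightarrow> (\<forall>m. Q b [m])"
    and p: "\<And>b xs. length xs = 1 \<Longrightarrow> computes b a p xs (of_bool (Q b xs))"
    using assms unfolding Pi_pred_def recursive_fun_def by auto
  have "recursive_with_parameter a (\<lambda>m b a. Q b [m])"
    unfolding recursive_with_parameter_def
    using p[of "[_]"] by (intro exI[of _ p]) (simp add: of_bool_def)
  with Q show "Pi01 a X" unfolding Pi01_def by (intro exI[of _ "\<lambda>m b a. Q b [m]"]) simp
qed

section \<open>Coded relations\<close>

definition pairs :: "nat set \<Rightarrow> (nat \<times> nat) set" where
  "pairs A = {(x, y). prod_encode (x, y) \<in> A}"

lemma mem_pairs [simp]: "(x, y) \<in> pairs A \<longleftrightarrow> prod_encode (x, y) \<in> A"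
  by (simp add: pairs_def)

lemma mem_set_decode_less:
  assumes "x \<in> set_decode n"
  shows "x < n"
proof -
  have "n div 2 ^ x \<noteq> 0" using assms by (auto simp: set_decode_def intro: odd_pos)
  then have "2 ^ x \<le> n" by (simp add: div_eq_0_iff)
  then show "x < n" using less_exp[of x] by linarith
qed

lemma pairs_set_decode_le:
  assumes "(x, y) \<in> pairs (set_decode n)"
  shows "x \<le> n" "y \<le> n"
  using assms le_prod_encode_1[of x y] le_prod_encode_2[of y x]
  by (auto dest!: mem_set_decode_less)

text \<open>
  A finite relation is coded by one number, so that a quantifier over finite relations is a
  quantifier over numbers.
\<close>

lemma finite_relation_coded: "finite R \<Longrightarrow> \<exists>n. pairs (set_decode n) = R"
  by (rule exI[of _ "set_encode (prod_encode ` R)"])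
    (auto simp: set_encode_inverse dest: prod_encode_eq[THEN iffD1])

lemma Ball_pairs_set_decode:
  "(\<forall>(x, y) \<in> pairs (set_decode n). P x y) \<longleftrightarrow>
   (\<forall>x\<le>n. \<forall>y\<le>n. (x, y) \<in> pairs (set_decode n) \<longrightarrow> P x y)"
  using pairs_set_decode_le by blast

abbreviation cons_code :: "nat \<Rightarrow> nat \<Rightarrow> nat" where
  "cons_code h t \<equiv> Suc (prod_encode (h, t))"

text \<open>Doubling is written as a sum, for which there is a rule \<open>recursive_plus\<close>.\<close>

abbreviation fun_code :: "nat \<Rightarrow> nat \<Rightarrow> nat" where
  "fun_code f l \<equiv> Suc (prod_encode (f, l) + prod_encode (f, l))"

lemma term_code_simps:
  "term_code num (Var x) = x + x"
  "term_code num (Fun f ts) = fun_code (num f) (list_encode (map (term_code num) ts))"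
  by (simp_all add: sum_encode_def)

lemma double_eq_iff: "m + m = n + n \<longleftrightarrow> m = n" "m + m \<noteq> Suc (n + n)" "Suc (n + n) \<noteq> m + m"
  for m n :: nat
  by presburger+

text \<open>
  A certificate \<open>V\<close> that two list codes agree except at one place, where their entries form a pair
  of \<open>E\<close>: the lists of every pair in \<open>V\<close> have either heads in \<open>E\<close> and equal tails, or equal heads and
  tails that are again in \<open>V\<close>.  Every condition concerns the immediate parts of a code, so that
  checking it requires bounded search only and no recursion over lists.
\<close>

definition one_place :: "(nat \<times> nat) set \<Rightarrow> (nat \<times> nat) set \<Rightarrow> bool" where
  "one_place E V \<longleftrightarrow> (\<forall>(l, l') \<in> V. \<exists>h t h' t'. l = cons_code h t \<and> l' = cons_code h' t' \<and>
     (h = h' \<and> (t, t') \<in> V \<or> (h, h') \<in> E \<and> t = t'))"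

text \<open>
  A certificate that \<open>S\<close> is part of the graph of a substitution on terms and \<open>V\<close> part of its graph
  on lists of terms.  The substitution need not be given: it can be read off from the codes \<open>x + x\<close>
  of variables in the domain of \<open>S\<close>.  \<open>T\<close> is the set of codes of terms.
\<close>

definition subst_graph :: "nat set \<Rightarrow> (nat \<times> nat) set \<Rightarrow> (nat \<times> nat) set \<Rightarrow> bool" where
  "subst_graph T S V \<longleftrightarrow>
     (\<forall>(u, v) \<in> S.
        (\<exists>x. u = x + x \<and> v \<in> T \<and> (\<forall>(w, v') \<in> S. w = u \<longrightarrow> v' = v)) \<or>
        (\<exists>f l l'. u = fun_code f l \<and> v = fun_code f l' \<and> (l, l') \<in> V)) \<and>
     (\<forall>(l, l') \<in> V. l = 0 \<and> l' = 0 \<or>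
        (\<exists>h t h' t'. l = cons_code h t \<and> l' = cons_code h' t' \<and> (h, h') \<in> S \<and> (t, t') \<in> V))"

text \<open>Both certificates can be checked by bounded search, because the parts of a code are bounded by it.\<close>

lemma cons_code_ge: "h \<le> cons_code h t" "t \<le> cons_code h t"
  using le_prod_encode_1[of h t] le_prod_encode_2[of t h] by simp_all

lemma fun_code_ge: "f \<le> fun_code f l" "l \<le> fun_code f l"
  using le_prod_encode_1[of f l] le_prod_encode_2[of l f] by simp_all

lemma ex_double_bounded: "(\<exists>x. u = x + x \<and> Q) \<longleftrightarrow> (\<exists>x\<le>u. u = x + x \<and> Q)"
  for u :: nat
  by (metis le_add1)

lemma ex_cons_codes_bounded:
  "(\<exists>h t h' t'. l = cons_code h t \<and> l' = cons_code h' t' \<and> Q h t h' t') \<longleftrightarrow>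
   (\<exists>h\<le>l. \<exists>t\<le>l. \<exists>h'\<le>l'. \<exists>t'\<le>l'. l = cons_code h t \<and> l' = cons_code h' t' \<and> Q h t h' t')"
  using cons_code_ge by metis

lemma ex_fun_codes_bounded:
  "(\<exists>f l l'. u = fun_code f l \<and> v = fun_code f l' \<and> Q l l') \<longleftrightarrow>
   (\<exists>f\<le>u. \<exists>l\<le>u. \<exists>l'\<le>v. u = fun_code f l \<and> v = fun_code f l' \<and> Q l l')"
  using fun_code_ge by metis

lemma one_place_bounded:
  "one_place E (pairs (set_decode n)) \<longleftrightarrow>
   (\<forall>l\<le>n. \<forall>l'\<le>n. (l, l') \<in> pairs (set_decode n) \<longrightarrow>
     (\<exists>h\<le>l. \<exists>t\<le>l. \<exists>h'\<le>l'. \<exists>t'\<le>l'. l = cons_code h t \<and> l' = cons_code h' t' \<and>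
       (h = h' \<and> (t, t') \<in> pairs (set_decode n) \<or> (h, h') \<in> E \<and> t = t')))"
  by (simp only: one_place_def Ball_pairs_set_decode ex_cons_codes_bounded)

lemma subst_graph_bounded:
  "subst_graph T (pairs (set_decode m)) (pairs (set_decode n)) \<longleftrightarrow>
     (\<forall>u\<le>m. \<forall>v\<le>m. (u, v) \<in> pairs (set_decode m) \<longrightarrow>
        (\<exists>x\<le>u. u = x + x \<and> v \<in> T \<and>
          (\<forall>w\<le>m. \<forall>v'\<le>m. (w, v') \<in> pairs (set_decode m) \<longrightarrow> w = u \<longrightarrow> v' = v)) \<or>
        (\<exists>f\<le>u. \<exists>l\<le>u. \<exists>l'\<le>v. u = fun_code f l \<and> v = fun_code f l' \<and>
          (l, l') \<in> pairs (set_decode n))) \<and>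
     (\<forall>l\<le>n. \<forall>l'\<le>n. (l, l') \<in> pairs (set_decode n) \<longrightarrow> l = 0 \<and> l' = 0 \<or>
        (\<exists>h\<le>l. \<exists>t\<le>l. \<exists>h'\<le>l'. \<exists>t'\<le>l'. l = cons_code h t \<and> l' = cons_code h' t' \<and>
          (h, h') \<in> pairs (set_decode m) \<and> (t, t') \<in> pairs (set_decode n)))"
  by (simp only: subst_graph_def Ball_pairs_set_decode ex_double_bounded ex_fun_codes_bounded
      ex_cons_codes_bounded)

lemma recursive_one_place:
  assumes "recursive_fun (join A B) k N"
  shows "recursive_pred (join A B) k (\<lambda>b xs. one_place (pairs b) (pairs (set_decode (N b xs))))"
  unfolding one_place_bounded mem_pairs by (intro recursive_intros assms)

lemma recursive_subst_graph:
  assumes "recursive_fun (join A B) k M" "recursive_fun (join A B) k N"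
  shows "recursive_pred (join A B) k
    (\<lambda>b xs. subst_graph {x. (x, x) \<in> pairs A} (pairs (set_decode (M b xs))) (pairs (set_decode (N b xs))))"
  unfolding subst_graph_bounded mem_pairs mem_Collect_eq by (intro recursive_intros assms)

section \<open>What the certificates certify\<close>

text \<open>
  Walking down the lists along the pairs of \<open>V\<close> must end at a pair of \<open>E\<close>, because no pair
  of \<open>V\<close> contains the code of the empty list.
\<close>

lemma one_place_differ:
  assumes "one_place E V" "(list_encode xs, l') \<in> V"
  shows "\<exists>us x x' vs. xs = us @ x # vs \<and> l' = list_encode (us @ x' # vs) \<and> (x, x') \<in> E"
  using assms(2)
proof (induction xs arbitrary: l')
  case Nil
  then show ?case using assms(1) unfolding one_place_def by fastforce
next
  case (Cons x xs)
  then obtain x' t' where l': "l' = cons_code x' t'"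
    and *: "x = x' \<and> (list_encode xs, t') \<in> V \<or> (x, x') \<in> E \<and> list_encode xs = t'"
    using assms(1) unfolding one_place_def by fastforce
  from * show ?case
  proof
    assume "x = x' \<and> (list_encode xs, t') \<in> V"
    with Cons.IH obtain us y y' vs where
      "xs = us @ y # vs" "t' = list_encode (us @ y' # vs)" "(y, y') \<in> E" by blast
    with \<open>x = x' \<and> _\<close> l' show ?thesis
      by (intro exI[of _ "x # us"] exI[of _ y] exI[of _ y'] exI[of _ vs]) simp
  next
    assume "(x, x') \<in> E \<and> list_encode xs = t'"
    with l' show ?thesis
      by (intro exI[of _ "[]"] exI[of _ x] exI[of _ x'] exI[of _ xs]) simp
  qed
qed

text \<open>
  The converse needs finite certificates only, since it is applied to coded ones: one pair for each
  tail of the list that still contains the place.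
\<close>

lemma one_place_exists:
  assumes "(x, x') \<in> E"
  shows "\<exists>V. finite V \<and> one_place E V \<and> (list_encode (us @ x # vs), list_encode (us @ x' # vs)) \<in> V"
proof (induction us)
  case Nil
  show ?case
    using assms by (intro exI[of _ "{(list_encode (x # vs), list_encode (x' # vs))}"])
      (auto simp: one_place_def)
next
  case (Cons u us)
  then obtain V where V: "finite V" "one_place E V"
    "(list_encode (us @ x # vs), list_encode (us @ x' # vs)) \<in> V" by blast
  let ?V = "insert (list_encode (u # us @ x # vs), list_encode (u # us @ x' # vs)) V"
  have "one_place E ?V"
    unfolding one_place_def
  proof (intro ballI, clarify)
    fix l l' assume "(l, l') \<in> ?V"
    then show "\<exists>h t h' t'. l = cons_code h t \<and> l' = cons_code h' t' \<and>
        (h = h' \<and> (t, t') \<in> ?V \<or> (h, h') \<in> E \<and> t = t')"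
    proof
      assume "(l, l') = (list_encode (u # us @ x # vs), list_encode (u # us @ x' # vs))"
      then have "l = cons_code u (list_encode (us @ x # vs))"
        "l' = cons_code u (list_encode (us @ x' # vs))" by simp_all
      with V(3) show ?thesis by blast
    next
      assume "(l, l') \<in> V"
      with V(2) have "\<exists>h t h' t'. l = cons_code h t \<and> l' = cons_code h' t' \<and>
          (h = h' \<and> (t, t') \<in> V \<or> (h, h') \<in> E \<and> t = t')"
        unfolding one_place_def by blast
      then show ?thesis by blast
    qed
  qed
  with V(1) show ?case by (intro exI[of _ ?V]) simp
qed

text \<open>
  The substitution sends \<open>x\<close> to the term whose code \<open>S\<close> assigns to \<open>x + x\<close>, and to \<open>x\<close> itself if \<open>S\<close>
  does not mention the variable.  Local correctness of \<open>S\<close> and \<open>V\<close> then propagates from the variables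
  to all terms in the domain of \<open>S\<close>, by induction on terms and on argument lists.
\<close>

lemma subst_graph_is_subst:
  assumes T: "T = term_code num ` terms L"
    and graph: "subst_graph T S V"
  obtains \<sigma> where "\<And>x. \<sigma> x \<in> terms L"
    and "\<And>s v. s \<in> terms L \<Longrightarrow> (term_code num s, v) \<in> S \<Longrightarrow> v = term_code num (subst \<sigma> s)"
proof -
  define \<sigma> where "\<sigma> x = (if \<exists>t. t \<in> terms L \<and> (x + x, term_code num t) \<in> S
    then SOME t. t \<in> terms L \<and> (x + x, term_code num t) \<in> S else Var x)" for x
  have S: "(\<exists>x. u = x + x \<and> v \<in> T \<and> (\<forall>(w, v') \<in> S. w = u \<longrightarrow> v' = v)) \<or>
      (\<exists>f l l'. u = fun_code f l \<and> v = fun_code f l' \<and> (l, l') \<in> V)" if "(u, v) \<in> S" for u v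
    using graph that unfolding subst_graph_def by blast
  have V: "l = 0 \<and> l' = 0 \<or>
      (\<exists>h t h' t'. l = cons_code h t \<and> l' = cons_code h' t' \<and> (h, h') \<in> S \<and> (t, t') \<in> V)"
    if "(l, l') \<in> V" for l l'
    using graph that unfolding subst_graph_def by blast
  have "v = term_code num (subst \<sigma> s)" if "s \<in> terms L" "(term_code num s, v) \<in> S" for s v
    using that
  proof (induction s arbitrary: v rule: terms.induct)
    case (Var x)
    then have xv: "(x + x, v) \<in> S" by (simp add: term_code_simps del: term_code.simps)
    then have v: "v \<in> T" "\<forall>(w, v') \<in> S. w = x + x \<longrightarrow> v' = v"
      using S[OF xv] by (auto simp: double_eq_iff)
    then have ex: "\<exists>t. t \<in> terms L \<and> (x + x, term_code num t) \<in> S" using xv T by blast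
    then have "(x + x, term_code num (\<sigma> x)) \<in> S"
      unfolding \<sigma>_def using someI_ex[OF ex] by simp
    with v(2) show ?case by auto
  next
    case (Fun f ts)
    then obtain l' where l': "v = fun_code (num f) l'" "(list_encode (map (term_code num) ts), l') \<in> V"
      using S[OF Fun.prems] by (auto simp: term_code_simps double_eq_iff simp del: term_code.simps)
    have "l' = list_encode (map (term_code num) (map (subst \<sigma>) ts))"
      using l'(2) Fun.IH
    proof (induction ts arbitrary: l')
      case Nil
      then show ?case using V by fastforce
    next
      case (Cons t ts)
      then show ?case using V[OF Cons.prems(1)] by (auto simp del: term_code.simps)
    qed
    with l'(1) show ?case by (simp add: term_code_simps del: term_code.simps)
  qed
  moreover have "\<sigma> x \<in> terms L" for x
    unfolding \<sigma>_def by (auto intro: terms.Var someI2_ex)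
  ultimately show thesis using that by blast
qed

text \<open>
  The converse, again with finite certificates.  Cutting the graph of a substitution at the codes
  below \<open>n\<close> makes it finite, and it stays locally correct because the parts of a code are smaller than the code.
\<close>

lemma subst_graph_exists:
  assumes inj: "inj_on num (dom L)" and \<sigma>: "\<And>x. \<sigma> x \<in> terms L"
  obtains S V where "finite S" "finite V" "subst_graph (term_code num ` terms L) S V"
    and "\<And>s. s \<in> terms L \<Longrightarrow> term_code num s < n \<Longrightarrow>
      (term_code num s, term_code num (subst \<sigma> s)) \<in> S"
proof -
  let ?c = "term_code num"
  let ?lc = "\<lambda>ts. list_encode (map ?c ts)"
  define D where "D = {s \<in> terms L. ?c s < n}"
  define Ds where "Ds = {ts \<in> lists (terms L). ?lc ts < n}"
  define S where "S = (\<lambda>s. (?c s, ?c (subst \<sigma> s))) ` D"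
  define V where "V = (\<lambda>ts. (?lc ts, ?lc (map (subst \<sigma>) ts))) ` Ds"
  have c_inj: "inj_on ?c (terms L)"
    using term_code_inj[OF inj] by (blast intro: inj_onI)
  have "finite D"
    by (rule inj_on_finite[of ?c D "{..<n}"]) (auto simp: D_def intro: inj_on_subset[OF c_inj])
  then have "finite S" unfolding S_def by simp
  have "inj_on ?lc (lists (terms L))"
    using inj_on_map_lists[OF c_inj]
    by (auto simp: inj_on_def list_encode_eq)
  then have "finite Ds"
    by (intro inj_on_finite[of ?lc Ds "{..<n}"]) (auto simp: Ds_def inj_on_def)
  then have "finite V" unfolding V_def by simp
  have "subst_graph (?c ` terms L) S V"
    unfolding subst_graph_def
  proof (intro conjI ballI; clarify)
    fix u v assume "(u, v) \<in> S"
      and no_fun: "\<nexists>f l l'. u = fun_code f l \<and> v = fun_code f l' \<and> (l, l') \<in> V"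
    then obtain s where s: "s \<in> terms L" "?c s < n" "u = ?c s" "v = ?c (subst \<sigma> s)"
      unfolding S_def D_def by auto
    show "\<exists>x. u = x + x \<and> v \<in> ?c ` terms L \<and> (\<forall>(w, v') \<in> S. w = u \<longrightarrow> v' = v)"
    proof (cases s)
      case (Var x)
      have "v' = v" if "(u, v') \<in> S" for v'
        using that s(1,3,4) term_code_inj[OF inj] unfolding S_def D_def by blast
      then show ?thesis
        using s Var \<sigma> by (intro exI[of _ x]) (auto simp: term_code_simps simp del: term_code.simps)
    next
      case (Fun f ts)
      then have u: "u = fun_code (num f) (?lc ts)"
        and v: "v = fun_code (num f) (?lc (map (subst \<sigma>) ts))"
        using s by (simp_all add: term_code_simps del: term_code.simps)
      have "?lc ts < n" using s(2,3) u fun_code_ge(2)[of "?lc ts" "num f"] by linarith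
      then have "(?lc ts, ?lc (map (subst \<sigma>) ts)) \<in> V"
        using s(1) Fun unfolding V_def Ds_def by (auto elim: terms_FunE)
      with u v no_fun show ?thesis by blast
    qed
  next
    fix l l' assume "(l, l') \<in> V"
      and no_cons: "\<nexists>h t h' t'. l = cons_code h t \<and> l' = cons_code h' t' \<and> (h, h') \<in> S \<and> (t, t') \<in> V"
    then obtain ts where ts: "ts \<in> lists (terms L)" "?lc ts < n" "l = ?lc ts"
      "l' = ?lc (map (subst \<sigma>) ts)" unfolding V_def Ds_def by auto
    show "l = 0 \<and> l' = 0"
    proof (cases ts)
      case Nil
      then show ?thesis using ts by simp
    next
      case (Cons r rs)
      then have l: "l = cons_code (?c r) (?lc rs)"
        and l': "l' = cons_code (?c (subst \<sigma> r)) (?lc (map (subst \<sigma>) rs))"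
        using ts by simp_all
      have "?c r < n" "?lc rs < n"
        using ts(2,3) l cons_code_ge[where h = "?c r" and t = "?lc rs"] by linarith+
      then have "(?c r, ?c (subst \<sigma> r)) \<in> S" "(?lc rs, ?lc (map (subst \<sigma>) rs)) \<in> V"
        using ts(1) Cons unfolding S_def D_def V_def Ds_def by auto
      with l l' no_cons show ?thesis by blast
    qed
  qed
  moreover have "(?c s, ?c (subst \<sigma> s)) \<in> S" if "s \<in> terms L" "?c s < n" for s
    using that unfolding S_def D_def by blast
  ultimately show thesis using that \<open>finite S\<close> \<open>finite V\<close> by blast
qed

section \<open>The interval in terms of codes\<close>

text \<open>
  The closure conditions on codes.  The certificates occur as hypotheses, so that in prenex form
  all unbounded quantifiers are universal.  Replacement is required for an immediate argument of
  a function symbol only: a replacement deeper in a term is a sequence of such steps outwards.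
  Reflexivity will come from the lower end of the interval.
\<close>

definition closed_codes :: "nat set \<Rightarrow> (nat \<times> nat) set \<Rightarrow> bool" where
  "closed_codes T E \<longleftrightarrow>
     (\<forall>x y. (x, y) \<in> E \<longrightarrow> (y, x) \<in> E) \<and>
     (\<forall>x y z. (x, y) \<in> E \<and> (y, z) \<in> E \<longrightarrow> (x, z) \<in> E) \<and>
     (\<forall>n f l l'. one_place E (pairs (set_decode n)) \<and> (l, l') \<in> pairs (set_decode n) \<and>
        fun_code f l \<in> T \<longrightarrow> (fun_code f l, fun_code f l') \<in> E) \<and>
     (\<forall>m n u u' v v'. subst_graph T (pairs (set_decode m)) (pairs (set_decode n)) \<and>
        (u, u') \<in> pairs (set_decode m) \<and> (v, v') \<in> pairs (set_decode m) \<and> (u, v) \<in> E \<longrightarrow>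
        (u', v') \<in> E)"

lemma Pi_closed_codes:
  "Pi_pred (join A B) 0 (\<lambda>b xs. closed_codes {x. (x, x) \<in> pairs A} (pairs b))"
  unfolding closed_codes_def
  by (intro Pi_conj Pi_all; rule Pi_recursive; unfold mem_pairs mem_Collect_eq)
    (intro recursive_one_place recursive_subst_graph[unfolded mem_pairs] recursive_intros)+

lemma mem_pairs_theory_code:
  "(x, y) \<in> pairs (theory_code num \<Phi>) \<longleftrightarrow>
   (\<exists>s t. (s, t) \<in> \<Phi> \<and> x = term_code num s \<and> y = term_code num t)"
  by (auto simp: theory_code_def equation_code_def image_iff Bex_def)

lemma code_mem_pairs_theory_code:
  assumes inj: "inj_on num (dom L)" and "\<Phi> \<subseteq> equations L" "s \<in> terms L" "t \<in> terms L"
  shows "(term_code num s, term_code num t) \<in> pairs (theory_code num \<Phi>) \<longleftrightarrow> (s, t) \<in> \<Phi>"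
  using term_code_inj[OF inj] assms(2-4) unfolding mem_pairs_theory_code equations_def
  by (metis mem_Sigma_iff subsetD)

text \<open>Reflexivity makes any equational theory decide which numbers are codes of terms.\<close>

lemma diagonal_theory_code:
  assumes "equational_theory L \<Phi>"
  shows "{x. (x, x) \<in> pairs (theory_code num \<Phi>)} = term_code num ` terms L"
proof -
  have "\<Phi> \<subseteq> terms L \<times> terms L" "\<And>s. s \<in> terms L \<Longrightarrow> (s, s) \<in> \<Phi>"
    using assms unfolding equational_theory_def equations_def by blast+
  then show ?thesis unfolding mem_pairs_theory_code by blast
qed

text \<open>
  Each certificate that the closure conditions accept describes a genuine replacement or
  substitution, under which an equational theory is closed.
\<close>

lemma closed_codes_if_equational_theory:
  assumes inj: "inj_on num (dom L)" and eq: "equational_theory L \<Phi>"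
  shows "closed_codes (term_code num ` terms L) (pairs (theory_code num \<Phi>))"
proof -
  let ?c = "term_code num" and ?E = "pairs (theory_code num \<Phi>)"
  have sub: "\<Phi> \<subseteq> equations L"
    and sym: "\<And>s t. (s, t) \<in> \<Phi> \<Longrightarrow> (t, s) \<in> \<Phi>"
    and trans: "\<And>s t u. (s, t) \<in> \<Phi> \<Longrightarrow> (t, u) \<in> \<Phi> \<Longrightarrow> (s, u) \<in> \<Phi>"
    and repl: "\<And>s s' t t'. (s, s') \<in> \<Phi> \<Longrightarrow> t \<in> terms L \<Longrightarrow> replace s s' t t' \<Longrightarrow> (t, t') \<in> \<Phi>"
    and substs: "\<And>s t \<sigma>. (s, t) \<in> \<Phi> \<Longrightarrow> (\<And>x. \<sigma> x \<in> terms L) \<Longrightarrow> (subst \<sigma> s, subst \<sigma> t) \<in> \<Phi>"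
    using eq unfolding equational_theory_def by blast+
  have in_terms: "s \<in> terms L" "t \<in> terms L" if "(s, t) \<in> \<Phi>" for s t
    using sub that by (auto simp: equations_def)
  note E_iff = mem_pairs_theory_code[of _ _ num \<Phi>]
  show ?thesis
    unfolding closed_codes_def
  proof (intro conjI allI impI; (elim conjE)?)
    fix x y assume "(x, y) \<in> ?E"
    then show "(y, x) \<in> ?E" unfolding E_iff using sym by blast
  next
    fix x y z assume "(x, y) \<in> ?E" "(y, z) \<in> ?E"
    then obtain s t t' u where "(s, t) \<in> \<Phi>" "(t', u) \<in> \<Phi>" "x = ?c s" "y = ?c t" "y = ?c t'" "z = ?c u"
      unfolding E_iff by blast
    moreover from this have "t = t'" using term_code_inj[OF inj] in_terms by metis
    ultimately show "(x, z) \<in> ?E" unfolding E_iff using trans by blast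
  next
    fix n f l l'
    assume V: "one_place ?E (pairs (set_decode n))" "(l, l') \<in> pairs (set_decode n)"
      and "fun_code f l \<in> ?c ` terms L"
    then obtain w where w: "w \<in> terms L" "fun_code f l = ?c w" by blast
    then obtain g ts where g: "w = Fun g ts"
      by (cases w) (auto simp: term_code_simps double_eq_iff simp del: term_code.simps)
    with w(2) have f: "f = num g" and l: "l = list_encode (map ?c ts)"
      by (auto simp: term_code_simps double_eq_iff simp del: term_code.simps)
    obtain us x x' vs where ts: "map ?c ts = us @ x # vs" "l' = list_encode (us @ x' # vs)"
      "(x, x') \<in> ?E"
      using one_place_differ[OF V(1)] V(2) l by blast
    then obtain us' t vs' where us': "ts = us' @ t # vs'" "us = map ?c us'" "x = ?c t" "vs = map ?c vs'"
      by (auto simp: map_eq_append_conv map_eq_Cons_conv)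
    obtain s s' where s: "(s, s') \<in> \<Phi>" "x = ?c s" "x' = ?c s'"
      using ts(3) unfolding E_iff by blast
    have "t \<in> terms L" using w(1) g us'(1) by (auto elim: terms_FunE)
    then have "s = t" using s us'(3) in_terms term_code_inj[OF inj] by metis
    then have "(w, Fun g (us' @ s' # vs')) \<in> \<Phi>"
      using repl[OF s(1) w(1)] g us'(1) by (auto intro: replace.intros)
    then show "(fun_code f l, fun_code f l') \<in> ?E"
      unfolding E_iff using w(2) f ts(2) us'(2,4) s(3)
      by (intro exI[of _ w] exI[of _ "Fun g (us' @ s' # vs')"])
        (simp add: term_code_simps del: term_code.simps)
  next
    fix m n u u' v v'
    assume graph: "subst_graph (?c ` terms L) (pairs (set_decode m)) (pairs (set_decode n))"
      and u: "(u, u') \<in> pairs (set_decode m)" and v: "(v, v') \<in> pairs (set_decode m)"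
      and "(u, v) \<in> ?E"
    then obtain s t where s: "(s, t) \<in> \<Phi>" "u = ?c s" "v = ?c t" unfolding E_iff by blast
    obtain \<sigma> where \<sigma>: "\<And>x. \<sigma> x \<in> terms L"
      "\<And>s v. s \<in> terms L \<Longrightarrow> (?c s, v) \<in> pairs (set_decode m) \<Longrightarrow> v = ?c (subst \<sigma> s)"
      using subst_graph_is_subst[OF refl graph] by blast
    have "u' = ?c (subst \<sigma> s)" "v' = ?c (subst \<sigma> t)"
      using \<sigma>(2) s u v in_terms[OF s(1)] by blast+
    moreover have "(subst \<sigma> s, subst \<sigma> t) \<in> \<Phi>" by (rule substs[OF s(1) \<sigma>(1)])
    ultimately show "(u', v') \<in> ?E"
      unfolding E_iff by (intro exI[of _ "subst \<sigma> s"] exI[of _ "subst \<sigma> t"]) simp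
  qed
qed

text \<open>
  Each replacement and each substitution has a finite certificate, so the closure conditions cover
  all of them.  Although a substitution acts on infinitely many variables, for a given equation
  only its graph on terms with codes up to those of the two sides matters.
\<close>

lemma equational_theory_if_closed_codes:
  assumes inj: "inj_on num (dom L)"
    and closed: "closed_codes (term_code num ` terms L) (pairs (theory_code num \<Phi>))"
    and sub: "\<Phi> \<subseteq> equations L"
    and refl: "\<And>s. s \<in> terms L \<Longrightarrow> (s, s) \<in> \<Phi>"
  shows "equational_theory L \<Phi>"
proof -
  let ?c = "term_code num" and ?E = "pairs (theory_code num \<Phi>)"
  note E_iff = code_mem_pairs_theory_code[OF inj sub]
  have sym: "(x, y) \<in> ?E \<Longrightarrow> (y, x) \<in> ?E"
    and trans: "(x, y) \<in> ?E \<Longrightarrow> (y, z) \<in> ?E \<Longrightarrow> (x, z) \<in> ?E" for x y z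
    using closed unfolding closed_codes_def by blast+
  have place: "(fun_code f l, fun_code f l') \<in> ?E"
    if "finite V" "one_place ?E V" "(l, l') \<in> V" "fun_code f l \<in> ?c ` terms L" for V f l l'
    using closed that finite_relation_coded[OF that(1)] unfolding closed_codes_def by blast
  have substs: "(u', v') \<in> ?E"
    if "finite S" "finite V" "subst_graph (?c ` terms L) S V" "(u, u') \<in> S" "(v, v') \<in> S" "(u, v) \<in> ?E"
    for S V u u' v v'
    using closed that finite_relation_coded[OF that(1)] finite_relation_coded[OF that(2)]
    unfolding closed_codes_def by blast
  have in_terms: "s \<in> terms L" "t \<in> terms L" if "(s, t) \<in> \<Phi>" for s t
    using sub that by (auto simp: equations_def)
  have Fun_mem: "Fun f ts \<in> terms L \<longleftrightarrow> L f = Some (length ts) \<and> set ts \<subseteq> terms L" for f ts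
    by (auto elim: terms_FunE intro: terms.Fun)
  have subst_terms: "subst \<sigma> s \<in> terms L" if "s \<in> terms L" "\<And>x. \<sigma> x \<in> terms L" for \<sigma> s
    using that(1) by induction (auto simp: that(2) intro!: terms.Fun)
  show ?thesis
    unfolding equational_theory_def
  proof (intro conjI allI impI ballI)
    show "\<Phi> \<subseteq> equations L" by (rule sub)
    show "(s, s) \<in> \<Phi>" if "s \<in> terms L" for s using refl that .
    show "(t, s) \<in> \<Phi>" if "(s, t) \<in> \<Phi>" for s t
      using sym E_iff in_terms[OF that] that by blast
    show "(s, u) \<in> \<Phi>" if "(s, t) \<in> \<Phi>" "(t, u) \<in> \<Phi>" for s t u
      using trans E_iff in_terms[OF that(1)] in_terms[OF that(2)] that by blast
    show "(t, t') \<in> \<Phi>" if st: "(s, s') \<in> \<Phi>" "t \<in> terms L" "replace s s' t t'" for s s' t t'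
      using st(3,2)
    proof (induction rule: replace.induct)
      case here
      show ?case by (rule st(1))
    next
      case (arg t t' f us vs)
      then have t: "(t, t') \<in> \<Phi>" by (auto simp: Fun_mem)
      have "(?c t, ?c t') \<in> ?E" using E_iff[OF in_terms[OF t]] t by blast
      from one_place_exists[OF this, of "map ?c us" "map ?c vs"] obtain V where "finite V" "one_place ?E V"
        "(list_encode (map ?c us @ ?c t # map ?c vs), list_encode (map ?c us @ ?c t' # map ?c vs)) \<in> V" by blast
      then have "(?c (Fun f (us @ t # vs)), ?c (Fun f (us @ t' # vs))) \<in> ?E"
        using place[of V _ _ "num f"] imageI[OF arg.prems, of ?c]
        by (simp add: term_code_simps del: term_code.simps mem_pairs)
      moreover have "Fun f (us @ t' # vs) \<in> terms L"
        using arg.prems in_terms[OF t] by (auto simp: Fun_mem)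
      ultimately show ?case using E_iff arg.prems by blast
    qed
    show "(subst \<sigma> s, subst \<sigma> t) \<in> \<Phi>" if st: "(s, t) \<in> \<Phi>" and \<sigma>: "\<forall>x. \<sigma> x \<in> terms L" for s t \<sigma>
    proof -
      obtain S V where "finite S" "finite V" "subst_graph (?c ` terms L) S V"
        and S: "\<And>r. r \<in> terms L \<Longrightarrow> ?c r < Suc (max (?c s) (?c t)) \<Longrightarrow> (?c r, ?c (subst \<sigma> r)) \<in> S"
        using subst_graph_exists[OF inj, of \<sigma> "Suc (max (?c s) (?c t))"] \<sigma> by blast
      moreover have "(?c s, ?c (subst \<sigma> s)) \<in> S" "(?c t, ?c (subst \<sigma> t)) \<in> S"
        using in_terms[OF st] by (auto intro!: S simp: less_Suc_eq_le)
      moreover have "(?c s, ?c t) \<in> ?E" using E_iff in_terms[OF st] st by blast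
      ultimately have "(?c (subst \<sigma> s), ?c (subst \<sigma> t)) \<in> ?E" using substs by blast
      then show ?thesis using E_iff subst_terms in_terms[OF st] \<sigma> by blast
    qed
  qed
qed

text \<open>
  The upper bound makes \<open>b\<close> a set of codes of equations, hence the code of some \<open>\<Phi>\<close>; the lower bound
  makes \<open>\<Phi>\<close> reflexive and, through its diagonal, decides which numbers are codes of terms.
\<close>

lemma mem_interval_codes_iff:
  assumes inj: "inj_on num (dom L)"
    and "equational_theory L \<Phi>\<^sub>0" "equational_theory L \<Phi>\<^sub>1"
  shows "b \<in> theory_code num ` theory_interval L \<Phi>\<^sub>0 \<Phi>\<^sub>1 \<longleftrightarrow>
    (\<forall>n. (n \<in> theory_code num \<Phi>\<^sub>0 \<longrightarrow> n \<in> b) \<and> (n \<in> b \<longrightarrow> n \<in> theory_code num \<Phi>\<^sub>1)) \<and>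
    closed_codes {x. (x, x) \<in> pairs (theory_code num \<Phi>\<^sub>0)} (pairs b)"
  (is "_ \<longleftrightarrow> ?between \<and> ?closed")
proof
  assume "b \<in> theory_code num ` theory_interval L \<Phi>\<^sub>0 \<Phi>\<^sub>1"
  then obtain \<Phi> where "b = theory_code num \<Phi>" "equational_theory L \<Phi>" "\<Phi>\<^sub>0 \<subseteq> \<Phi>" "\<Phi> \<subseteq> \<Phi>\<^sub>1"
    unfolding theory_interval_def by blast
  moreover from this have "?closed"
    unfolding diagonal_theory_code[OF assms(2)]
    using closed_codes_if_equational_theory[OF inj] by simp
  ultimately show "?between \<and> ?closed" by (auto simp: theory_code_def)
next
  assume *: "?between \<and> ?closed"
  define \<Phi> where "\<Phi> = {e \<in> \<Phi>\<^sub>1. equation_code num e \<in> b}"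
  have sub: "\<Phi>\<^sub>0 \<subseteq> equations L" "\<Phi>\<^sub>1 \<subseteq> equations L"
    using assms(2,3) by (simp_all add: equational_theory_def)
  have b: "b = theory_code num \<Phi>"
    using conjunct1[OF *] by (auto simp: \<Phi>_def theory_code_def)
  have "\<Phi>\<^sub>0 \<subseteq> \<Phi>"
  proof
    fix e assume e: "e \<in> \<Phi>\<^sub>0"
    then have eb: "equation_code num e \<in> b"
      using conjunct1[OF *] by (simp add: theory_code_def)
    then obtain e' where "e' \<in> \<Phi>\<^sub>1" "equation_code num e' = equation_code num e"
      using conjunct1[OF *] by (auto simp: theory_code_def)
    then have "e \<in> \<Phi>\<^sub>1" using equation_code_inj_on[OF inj] sub e by (metis inj_onD subsetD)
    with eb show "e \<in> \<Phi>" unfolding \<Phi>_def by blast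
  qed
  moreover have "equational_theory L \<Phi>"
  proof (rule equational_theory_if_closed_codes[OF inj])
    show "closed_codes (term_code num ` terms L) (pairs (theory_code num \<Phi>))"
      using conjunct2[OF *] unfolding diagonal_theory_code[OF assms(2)] b .
    show "\<Phi> \<subseteq> equations L" using sub(2) by (auto simp: \<Phi>_def)
    show "(s, s) \<in> \<Phi>" if "s \<in> terms L" for s
      using assms(2) that \<open>\<Phi>\<^sub>0 \<subseteq> \<Phi>\<close> by (auto simp: equational_theory_def)
  qed
  moreover have "\<Phi> \<subseteq> \<Phi>\<^sub>1" unfolding \<Phi>_def by blast
  ultimately have "\<Phi> \<in> theory_interval L \<Phi>\<^sub>0 \<Phi>\<^sub>1" unfolding theory_interval_def by blast
  with b show "b \<in> theory_code num ` theory_interval L \<Phi>\<^sub>0 \<Phi>\<^sub>1" by (rule image_eqI)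
qed

theorem lemma3p1:
  fixes L :: "'f \<rightharpoonup> nat"
    and num :: "'f \<Rightarrow> nat"
    and \<Phi>\<^sub>0 \<Phi>\<^sub>1 :: "'f equation set"
  assumes "countable (dom L)"
    and "inj_on num (dom L)"
    and "equational_theory L \<Phi>\<^sub>0"
    and "equational_theory L \<Phi>\<^sub>1"
  shows "Pi01 (join (theory_code num \<Phi>\<^sub>0) (theory_code num \<Phi>\<^sub>1))
           (theory_code num ` theory_interval L \<Phi>\<^sub>0 \<Phi>\<^sub>1)"
proof (rule Pi01_if_Pi_pred)
  let ?A = "theory_code num \<Phi>\<^sub>0" and ?B = "theory_code num \<Phi>\<^sub>1"
  have "Pi_pred (join ?A ?B) 0 (\<lambda>b xs. \<forall>n. (n \<in> ?A \<longrightarrow> n \<in> b) \<and> (n \<in> b \<longrightarrow> n \<in> ?B))"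
    by (rule Pi_all, rule Pi_recursive) (intro recursive_intros)
  from Pi_conj[OF this Pi_closed_codes]
  show "Pi_pred (join ?A ?B) 0 (\<lambda>b xs. b \<in> theory_code num ` theory_interval L \<Phi>\<^sub>0 \<Phi>\<^sub>1)"
    unfolding mem_interval_codes_iff[OF assms(2-4)] .
qed

end
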